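(* Suppose that one of the following conditions is satisfied: (a) $\alpha\le d$; (b) the weight distribution satisfies $1-F(w)\ge c\,w^{-(\tau-1)}$ for all sufficiently large $w$, for some $c>0$ and $\tau>1$ such that $\gamma:=\alpha(\tau-1)/d\le 1$. Then for $\mathrm P$-almost every $\eta$ it holds that, $P^\eta$-almost surely, all points in $\eta$ have infinite degree.
   Context: Model (scale-free percolation in continuum space). Fix $d\ge 1$, $\nu>0$, $\alpha>0$. The vertex set is a homogeneous Poisson point process $\eta$ in $\mathbb R^d$ of intensity $\nu$, with law $\mathrm P$. Given $\eta$, each $x\in\eta$ receives a random weight $W_x>0$; the weights are i.i.d. with law $P$ and distribution function $F$, which is regularly varying at infinity: $1-F(w)=P(W>w)=w^{-(\tau_0-1)}L(w)$ for some $\tau_0>1$ and some function $L$ slowly varying at $+\infty$. Given $\eta$ and the weights $(w_x)_{x\in\eta}$, each unordered pair of distinct $x,y\in\eta$ is joined by an undirected edge (written $x\leftrightarrow y$), independently over pairs, with probability $1-\exp\{-w_xw_y/\|x-y\|^{\alpha}\}$, where $\|\cdot\|$ is the Euclidean norm. $P^\eta$ denotes the quenched law of the random graph (weights and edges) given $\eta$. The degree of $x\in\eta$ is $D_x:=\#\{y\in\eta: y\leftrightarrow x\}$. *)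

theory Defs
  imports "HOL-Probability.Probability"
begin

section \<open>Homogeneous Poisson point processes on Euclidean space\<close>

definition locally_finite :: "'a::metric_space set \<Rightarrow> bool" where
  "locally_finite \<eta> \<longleftrightarrow> (\<forall>A. bounded A \<longrightarrow> finite (\<eta> \<inter> A))"

text \<open>A homogeneous Poisson process has almost surely no multiple points, so its realisations are
  locally finite sets of points. They carry the sigma-algebra generated by the numbers of points
  in bounded Borel sets.\<close>

definition configuration_space :: "(real ^ 'n) set measure" where
  "configuration_space =
     sigma {\<eta>. locally_finite \<eta>}
       {{\<eta>. locally_finite \<eta> \<and> card (\<eta> \<inter> A) = k} | A k. bounded A \<and> A \<in> sets borel}"

text \<open>The Poisson probabilities are written out, rather than taken from \<^const>\<open>poisson_pmf\<close>,
  because the parameter is 0 for null sets; there \<open>0 ^ 0 = 1\<close> gives the point mass at 0.\<close>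

definition poisson_process_law :: "real \<Rightarrow> (real ^ 'n) set measure \<Rightarrow> bool" where
  "poisson_process_law \<nu> P \<longleftrightarrow>
     prob_space P \<and> space P = space configuration_space \<and> sets P = sets configuration_space \<and>
     (\<forall>A k. bounded A \<and> A \<in> sets borel \<longrightarrow>
        measure P {\<eta> \<in> space P. card (\<eta> \<inter> A) = k} =
          (\<nu> * measure lborel A) ^ k / fact k * exp (- (\<nu> * measure lborel A))) \<and>
     (\<forall>A (I :: nat set). (\<forall>i\<in>I. bounded (A i) \<and> A i \<in> sets borel) \<and> disjoint_family_on A I \<longrightarrow>
        prob_space.indep_vars P (\<lambda>_. count_space UNIV) (\<lambda>i \<eta>. card (\<eta> \<inter> A i)) I)"


section \<open>Regularly varying weights\<close>

definition slowly_varying :: "(real \<Rightarrow> real) \<Rightarrow> bool" where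
  "slowly_varying L \<longleftrightarrow>
     L \<in> borel_measurable (restrict_space borel {0<..}) \<and>
     eventually (\<lambda>x. L x > 0) at_top \<and>
     (\<forall>t>0. ((\<lambda>x. L (t * x) / L x) \<longlongrightarrow> 1) at_top)"


section \<open>The random graph given the points\<close>

text \<open>An unordered pair of distinct points is a two-element set, a realisation of the graph given
  the point set \<open>\<eta>\<close> consists of the weights of the points and the indicators of the edges.\<close>

type_synonym 'a weighted_graph = "('a \<Rightarrow> real) \<times> ('a set \<Rightarrow> bool)"

definition vertex_pairs :: "'a set \<Rightarrow> 'a set set" where
  "vertex_pairs \<eta> = {{x, y} | x y. x \<in> \<eta> \<and> y \<in> \<eta> \<and> x \<noteq> y}"

text \<open>The product of the weights and the diameter express \<open>w x * w y\<close> and \<open>norm (x - y)\<close>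
  as functions of the unordered pair \<open>{x, y}\<close>. For positive weights the value lies in \<open>[0, 1]\<close>;
  outside that interval \<^const>\<open>bernoulli_pmf\<close> clips its parameter, on a null set of weights.\<close>

definition edge_prob :: "real \<Rightarrow> ('a::real_normed_vector \<Rightarrow> real) \<Rightarrow> 'a set \<Rightarrow> real" where
  "edge_prob \<alpha> w e = 1 - exp (- ((\<Prod>z\<in>e. w z) / diameter e powr \<alpha>))"

lemma diameter_pair: "diameter {x, y :: 'a::real_normed_vector} = norm (x - y)"
proof (rule antisym)
  show "diameter {x, y} \<le> norm (x - y)"
    by (rule diameter_le) (auto simp: norm_minus_commute)
  have "dist x y \<le> diameter {x, y}"
    by (rule diameter_bounded_bound) auto
  then show "norm (x - y) \<le> diameter {x, y}"
    by (simp add: dist_norm)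
qed

lemma edge_prob_pair:
  "x \<noteq> y \<Longrightarrow> edge_prob \<alpha> w {x, y} = 1 - exp (- (w x * w y / norm (x - y) powr \<alpha>))"
  by (simp add: edge_prob_def diameter_pair)

definition edge_law ::
  "real \<Rightarrow> 'a::real_normed_vector set \<Rightarrow> ('a \<Rightarrow> real) \<Rightarrow> ('a set \<Rightarrow> bool) measure" where
  "edge_law \<alpha> \<eta> w = PiM (vertex_pairs \<eta>) (\<lambda>e. measure_pmf (bernoulli_pmf (edge_prob \<alpha> w e)))"

definition graph_space :: "'a set \<Rightarrow> 'a weighted_graph measure" where
  "graph_space \<eta> = PiM \<eta> (\<lambda>_. borel) \<Otimes>\<^sub>M PiM (vertex_pairs \<eta>) (\<lambda>_. count_space UNIV)"

text \<open>\<open>D\<close> is the law of a single weight. First the weights are drawn, then, given the weights,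
  the edges.\<close>

definition quenched_law ::
  "real measure \<Rightarrow> real \<Rightarrow> 'a::real_normed_vector set \<Rightarrow> 'a weighted_graph measure" where
  "quenched_law D \<alpha> \<eta> =
     PiM \<eta> (\<lambda>_. D) \<bind> (\<lambda>w. distr (edge_law \<alpha> \<eta> w) (graph_space \<eta>) (\<lambda>E. (w, E)))"

text \<open>\<^const>\<open>bind\<close> is only meaningful for a measurable kernel, so measurability has to be checked.\<close>

context
begin

interpretation pmf_as_function .

lemma pmf_bernoulli_clipped:
  "pmf (bernoulli_pmf p) b = (if b then min 1 (max 0 p) else 1 - min 1 (max 0 p))"
  by transfer simp

end

lemma measurable_edge_law:
  fixes \<eta> :: "'a::real_normed_vector set"
  assumes D: "sets D = sets borel"
  shows "edge_law \<alpha> \<eta> \<in> PiM \<eta> (\<lambda>_. D) \<rightarrow>\<^sub>M prob_algebra (PiM (vertex_pairs \<eta>) (\<lambda>_. count_space UNIV))"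
proof (rule measurable_prob_algebra_generated[OF sets_PiM Int_stable_prod_algebra
      prod_algebra_sets_into_space])
  fix w
  show "prob_space (edge_law \<alpha> \<eta> w)"
    unfolding edge_law_def by (intro prob_space_PiM prob_space_measure_pmf)
  show "sets (edge_law \<alpha> \<eta> w) = sets (PiM (vertex_pairs \<eta>) (\<lambda>_. count_space UNIV))"
    unfolding edge_law_def by (intro sets_PiM_cong) auto
next
  fix X assume "X \<in> prod_algebra (vertex_pairs \<eta>) (\<lambda>_. count_space (UNIV :: bool set))"
  then obtain J Y where X:
      "X = prod_emb (vertex_pairs \<eta>) (\<lambda>_. count_space (UNIV :: bool set)) J (\<Pi>\<^sub>E j\<in>J. Y j)"
    and J: "finite J" "J \<noteq> {} \<or> vertex_pairs \<eta> = {}" "J \<subseteq> vertex_pairs \<eta>"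
    by (rule prod_algebraE)
  have eq: "emeasure (edge_law \<alpha> \<eta> w) X =
      (\<Prod>j\<in>J. \<Sum>b\<in>Y j. ennreal (pmf (bernoulli_pmf (edge_prob \<alpha> w j)) b))" for w
  proof -
    interpret product_prob_space "\<lambda>e. measure_pmf (bernoulli_pmf (edge_prob \<alpha> w e))" "vertex_pairs \<eta>"
      by unfold_locales
    have "X = prod_emb (vertex_pairs \<eta>) (\<lambda>e. measure_pmf (bernoulli_pmf (edge_prob \<alpha> w e))) J
        (\<Pi>\<^sub>E j\<in>J. Y j)"
      by (simp add: X prod_emb_def)
    then show ?thesis
      using J by (simp add: edge_law_def emeasure_PiM_emb emeasure_measure_pmf_finite)
  qed
  have meas: "(\<lambda>w. edge_prob \<alpha> w j) \<in> borel_measurable (PiM \<eta> (\<lambda>_. D))" if "j \<in> J" for j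
  proof -
    have "j \<subseteq> \<eta>"
      using that J(3) by (auto simp: vertex_pairs_def)
    then have "(\<lambda>w. w z) \<in> borel_measurable (PiM \<eta> (\<lambda>_. D))" if "z \<in> j" for z
      using measurable_component_singleton[of z \<eta> "\<lambda>_. D"] that D
      by (auto simp: measurable_cong_sets[OF refl D])
    then show ?thesis
      unfolding edge_prob_def by measurable
  qed
  show "(\<lambda>w. emeasure (edge_law \<alpha> \<eta> w) X) \<in> borel_measurable (PiM \<eta> (\<lambda>_. D))"
    unfolding eq pmf_bernoulli_clipped
  proof (intro borel_measurable_prod_ennreal borel_measurable_sum)
    fix j b assume j: "j \<in> J"
    note [measurable] = meas[OF j]
    show "(\<lambda>w. ennreal (if b then min 1 (max 0 (edge_prob \<alpha> w j))
        else 1 - min 1 (max 0 (edge_prob \<alpha> w j)))) \<in> borel_measurable (PiM \<eta> (\<lambda>_. D))"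
      by (cases b) simp_all
  qed
qed

lemma measurable_quenched_kernel:
  fixes \<eta> :: "'a::real_normed_vector set"
  assumes D: "sets D = sets borel"
  shows "(\<lambda>w. distr (edge_law \<alpha> \<eta> w) (graph_space \<eta>) (\<lambda>E. (w, E)))
    \<in> PiM \<eta> (\<lambda>_. D) \<rightarrow>\<^sub>M prob_algebra (graph_space \<eta>)"
proof (rule measurable_distr_prob_space2[OF measurable_edge_law[OF D]])
  have "sets (PiM \<eta> (\<lambda>_. D)) = sets (PiM \<eta> (\<lambda>_. borel))"
    by (intro sets_PiM_cong refl D)
  then show "(\<lambda>(x, y). (x, y))
      \<in> PiM \<eta> (\<lambda>_. D) \<Otimes>\<^sub>M PiM (vertex_pairs \<eta>) (\<lambda>_. count_space UNIV) \<rightarrow>\<^sub>M graph_space \<eta>"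
    unfolding graph_space_def by (simp add: measurable_ident_sets[OF sets_pair_measure_cong] id_def)
qed

lemma prob_space_quenched_law:
  fixes \<eta> :: "'a::real_normed_vector set"
  assumes "real_distribution D"
  shows "prob_space (quenched_law D \<alpha> \<eta>)" "sets (quenched_law D \<alpha> \<eta>) = sets (graph_space \<eta>)"
proof -
  interpret D: real_distribution D by fact
  interpret P: prob_space "PiM \<eta> (\<lambda>_. D)"
    by (intro prob_space_PiM D.prob_space_axioms)
  note K = measurable_quenched_kernel[OF D.events_eq_borel, of \<alpha> \<eta>]
  have "PiM \<eta> (\<lambda>_. D) \<in> space (prob_algebra (PiM \<eta> (\<lambda>_. D)))"
    by (simp add: space_prob_algebra P.prob_space_axioms)
  from prob_space_bind'[OF this K] sets_bind'[OF this K]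
  show "prob_space (quenched_law D \<alpha> \<eta>)" "sets (quenched_law D \<alpha> \<eta>) = sets (graph_space \<eta>)"
    by (simp_all add: quenched_law_def)
qed

definition vertex_degree :: "'a set \<Rightarrow> 'a weighted_graph \<Rightarrow> 'a \<Rightarrow> enat" where
  "vertex_degree \<eta> G x =
     (let N = {y \<in> \<eta>. y \<noteq> x \<and> snd G {x, y}} in if finite N then enat (card N) else \<infinity>)"

end

theory Submission
  imports Defs "HOL-Real_Asymp.Real_Asymp"
begin

text \<open>Both steps of the randomness are handled by the same second Borel--Cantelli type statement: if the
  expectations of independent \<open>[0, 1]\<close>-valued variables have a divergent sum, then so do the variables
  themselves, almost surely. Almost every \<open>\<eta>\<close> has at least \<open>b * 2 ^ (k * d)\<close> points in the \<open>k\<close>-th dyadic shell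
  for all large \<open>k\<close>, while \<open>E (1 - exp (- a W / r powr \<alpha>)) \<ge> c r powr (- d)\<close> for large \<open>r\<close>: in case (a) a typical
  weight already achieves this, in case (b) the weights above \<open>r powr \<alpha>\<close> do. So each shell contributes a
  constant and the sum over \<open>y \<in> \<eta>\<close> diverges. Applied to the weights with \<open>a = 1 / n\<close>, and then to the edges
  given the weights, the statement yields infinitely many neighbours.\<close>

section \<open>Divergence of sums of independent bounded variables\<close>

text \<open>For nonnegative terms the finite partial sums increase with the index set, so divergence
  is the same as unboundedness. Finite subsets replace initial segments, which avoids enumerating
  points or edges.\<close>

lemma not_summable_on_iff:
  fixes f :: "'a \<Rightarrow> real"
  assumes "\<And>i. i \<in> I \<Longrightarrow> 0 \<le> f i"
  shows "\<not> f summable_on I \<longleftrightarrow> (\<forall>B. \<exists>F. finite F \<and> F \<subseteq> I \<and> B < sum f F)"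
proof
  assume "\<not> f summable_on I"
  then show "\<forall>B. \<exists>F. finite F \<and> F \<subseteq> I \<and> B < sum f F"
    using nonneg_bounded_partial_sums_imp_summable_on[of I f] assms
    by (metis (no_types, lifting) eventually_finite_subsets_at_top_weakI linorder_not_le)
next
  assume unb: "\<forall>B. \<exists>F. finite F \<and> F \<subseteq> I \<and> B < sum f F"
  show "\<not> f summable_on I"
  proof
    assume "f summable_on I"
    then have "sum f F \<le> infsum f I" if "finite F" "F \<subseteq> I" for F
      using that assms by (intro finite_sum_le_infsum) auto
    then show False
      using unb by (meson linorder_not_le)
  qed
qed

text \<open>The set where \<open>P\<close> fails is not assumed to be an event: covering it by
  events of probability at most \<open>1 / (n + 1)\<close> and intersecting these gives a null set.
  This permits statements about sums over arbitrary index sets.\<close>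

lemma (in prob_space) AE_I_prob_small:
  assumes "\<And>e. e > 0 \<Longrightarrow> \<exists>A\<in>events. {x \<in> space M. \<not> P x} \<subseteq> A \<and> prob A \<le> e"
  shows "AE x in M. P x"
proof -
  have "\<exists>A. \<forall>n. A n \<in> events \<and> {x \<in> space M. \<not> P x} \<subseteq> A n \<and> prob (A n) \<le> inverse (real (Suc n))"
    using assms by (intro choice allI) (metis inverse_positive_iff_positive of_nat_0_less_iff zero_less_Suc)
  then obtain A where A: "\<And>n. A n \<in> events" "\<And>n. {x \<in> space M. \<not> P x} \<subseteq> A n"
    "\<And>n. prob (A n) \<le> inverse (real (Suc n))"
    by metis
  have ev: "(\<Inter>n. A n) \<in> events"
    using A(1) by auto
  have "prob (\<Inter>n. A n) \<le> inverse (real (Suc n))" for n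
    by (rule order_trans[OF finite_measure_mono A(3)]) (use A(1) in auto)
  then have "prob (\<Inter>n. A n) \<le> 0"
    by (intro LIMSEQ_le_const[OF LIMSEQ_inverse_real_of_nat]) auto
  then have "(\<Inter>n. A n) \<in> null_sets M"
    using ev by (simp add: null_sets_def emeasure_eq_measure measure_nonneg antisym)
  moreover have "{x \<in> space M. \<not> P x} \<subseteq> (\<Inter>n. A n)"
    using A(2) by blast
  ultimately show ?thesis
    by (rule AE_I')
qed

text \<open>By convexity the graph of \<open>exp (- x)\<close> lies below the chord over
  \<open>[0, 1]\<close>, and the right endpoint satisfies \<open>exp (- 1) \<le> 1 / 2\<close>. The
  linear bound is what survives taking expectations.\<close>

lemma exp_minus_le_chord:
  fixes x :: real
  assumes "0 \<le> x" "x \<le> 1"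
  shows "exp (- x) \<le> 1 - x / 2"
proof -
  have "(1::real) + 1 \<le> exp 1"
    by (rule exp_ge_add_one_self)
  then have "exp (- 1 :: real) \<le> 1 / 2"
    by (simp add: exp_minus field_simps)
  moreover have "exp ((1 - x) *\<^sub>R 0 + x *\<^sub>R (- 1)) \<le> (1 - x) * exp 0 + x * exp (- 1 :: real)"
    using assms by (intro convex_onD[OF exp_convex]) auto
  ultimately show ?thesis
    using mult_left_mono[of "exp (- 1)" "1 / 2" x] assms by simp
qed

text \<open>The Chernoff bound \<open>E exp (- \<Sum>i\<in>F. X i) \<le> exp (- (\<Sum>i\<in>F. E (X i)) / 2)\<close> makes bounded sums
  arbitrarily unlikely.\<close>

lemma (in prob_space) AE_indep_vars_not_summable_on:
  fixes X :: "'i \<Rightarrow> 'a \<Rightarrow> real"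
  assumes indep: "indep_vars (\<lambda>_. borel) X I"
    and X: "\<And>i x. i \<in> I \<Longrightarrow> 0 \<le> X i x" "\<And>i x. i \<in> I \<Longrightarrow> X i x \<le> 1"
    and div: "\<not> (\<lambda>i. expectation (X i)) summable_on I"
  shows "AE x in M. \<not> (\<lambda>i. X i x) summable_on I"
proof -
  have rv[measurable]: "random_variable borel (X i)" if "i \<in> I" for i
    using indep that by (auto simp: indep_vars_def)
  have int: "integrable M (X i)" if "i \<in> I" for i
    using that X by (intro integrable_const_bound[where B = 1]) auto
  have small: "prob {x \<in> space M. sum (\<lambda>i. X i x) F \<le> B} \<le> exp (B - (\<Sum>i\<in>F. expectation (X i)) / 2)"
    if F: "finite F" "F \<subseteq> I" for F B
  proof -
    have [measurable]: "\<And>i. i \<in> F \<Longrightarrow> random_variable borel (X i)"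
      using F by auto
    have inte: "integrable M (\<lambda>x. exp (- X i x))" if "i \<in> F" for i
      using that F X by (intro integrable_const_bound[where B = 1]) auto
    have ind: "indep_vars (\<lambda>_. borel) (\<lambda>i x. exp (- X i x)) F"
      by (rule indep_vars_compose2[OF indep_vars_subset[OF indep F(2)]]) measurable
    have le1: "expectation (\<lambda>x. exp (- X i x)) \<le> exp (- (expectation (X i) / 2))" if "i \<in> F" for i
    proof -
      have "expectation (\<lambda>x. exp (- X i x)) \<le> expectation (\<lambda>x. 1 - X i x / 2)"
        using that F X int by (intro integral_mono inte exp_minus_le_chord) auto
      also have "\<dots> = 1 - expectation (X i) / 2"
        using int[of i] that F by (auto simp: prob_space)
      also have "\<dots> \<le> exp (- (expectation (X i) / 2))"
        using exp_ge_add_one_self[of "- (expectation (X i) / 2)"] by simp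
      finally show ?thesis .
    qed
    have "prob {x \<in> space M. sum (\<lambda>i. X i x) F \<le> B} =
        prob {x \<in> space M. exp (- B) \<le> (\<Prod>i\<in>F. exp (- X i x))}"
      by (simp add: exp_sum[symmetric] sum_negf F)
    also have "\<dots> \<le> expectation (\<lambda>x. \<Prod>i\<in>F. exp (- X i x)) / exp (- B)"
      using ind F by (intro integral_Markov_inequality_measure[where A = "{}"] indep_vars_integrable inte)
        (auto intro!: prod_nonneg)
    also have "\<dots> = (\<Prod>i\<in>F. expectation (\<lambda>x. exp (- X i x))) * exp B"
      using indep_vars_lebesgue_integral[OF F(1) ind inte]
      by (simp only: exp_minus[of B] divide_inverse inverse_inverse_eq)
    also have "\<dots> \<le> (\<Prod>i\<in>F. exp (- (expectation (X i) / 2))) * exp B"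
      using le1 by (intro mult_right_mono prod_mono conjI integral_nonneg_AE) auto
    also have "\<dots> = exp (B - (\<Sum>i\<in>F. expectation (X i)) / 2)"
      by (simp add: exp_sum[symmetric] F exp_add[symmetric] sum_negf sum_divide_distrib)
    finally show ?thesis .
  qed
  \<comment> \<open>Natural levels \<open>B\<close> suffice and are countable, so the exceptional
    null sets can be united.\<close>
  have "AE x in M. \<exists>F. finite F \<and> F \<subseteq> I \<and> real B < (\<Sum>i\<in>F. X i x)" for B :: nat
  proof (rule AE_I_prob_small)
    fix e :: real assume "e > 0"
    \<comment> \<open>The threshold \<open>2 * (B - ln e)\<close> is the one for which the bound
      \<open>exp (B - S / 2)\<close>, with \<open>S\<close> the sum of the expectations, drops below
      \<open>exp (ln e) = e\<close>.\<close>
    obtain F where F: "finite F" "F \<subseteq> I" "2 * (B - ln e) < (\<Sum>i\<in>F. expectation (X i))"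
      using not_summable_on_iff[THEN iffD1, OF Bochner_Integration.integral_nonneg[OF X(1)] div]
      by blast
    have [measurable]: "\<And>i. i \<in> F \<Longrightarrow> random_variable borel (X i)"
      using F by auto
    have "exp (B - (\<Sum>i\<in>F. expectation (X i)) / 2) \<le> exp (ln e)"
      using F by simp
    then have "prob {x \<in> space M. (\<Sum>i\<in>F. X i x) \<le> B} \<le> e"
      using small[OF F(1,2), of B] \<open>e > 0\<close> by simp
    moreover have "{x \<in> space M. (\<Sum>i\<in>F. X i x) \<le> B} \<in> events"
      by measurable
    ultimately show "\<exists>A\<in>events. {x \<in> space M. \<not> (\<exists>F. finite F \<and> F \<subseteq> I \<and> real B < (\<Sum>i\<in>F. X i x))} \<subseteq> A
        \<and> prob A \<le> e"
      using F by (intro bexI[of _ "{x \<in> space M. (\<Sum>i\<in>F. X i x) \<le> B}"]) (auto simp: not_less)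
  qed
  then have "AE x in M. \<forall>B::nat. \<exists>F. finite F \<and> F \<subseteq> I \<and> real B < (\<Sum>i\<in>F. X i x)"
    by (simp add: AE_all_countable)
  then show ?thesis
  proof eventually_elim
    case (elim x)
    have "\<forall>B. \<exists>F. finite F \<and> F \<subseteq> I \<and> B < (\<Sum>i\<in>F. X i x)"
    proof
      fix B :: real
      obtain n :: nat where "B \<le> n"
        using real_arch_simple by blast
      with elim show "\<exists>F. finite F \<and> F \<subseteq> I \<and> B < (\<Sum>i\<in>F. X i x)"
        by (meson le_less_trans)
    qed
    then show ?case
      using not_summable_on_iff[of I "\<lambda>i. X i x"] X(1) by blast
  qed
qed

text \<open>Independence amounts to the joint law being the product of the marginals. Here the joint
  map is the identity on the product space and the marginals are the factors. The criterion asks for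
  a nonempty index set, hence the case split.\<close>

lemma (in product_prob_space) indep_vars_component: "indep_vars M (\<lambda>i x. x i) I"
proof (cases "I = {}")
  case True
  then show ?thesis
    unfolding P.indep_vars_def P.indep_sets_def by simp
next
  case False
  have "distr (PiM I M) (PiM I M) (\<lambda>x. \<lambda>i\<in>I. x i) = distr (PiM I M) (PiM I M) (\<lambda>x. x)"
    by (rule distr_cong) (auto simp: space_PiM PiE_def extensional_restrict)
  moreover have "(\<Pi>\<^sub>M i\<in>I. distr (PiM I M) (M i) (\<lambda>x. x i)) = PiM I M"
    by (intro PiM_cong refl) (simp add: PiM_component)
  ultimately show ?thesis
    using False by (subst indep_vars_iff_distr_eq_PiM') simp_all
qed

text \<open>The subset \<open>J\<close> allows the same product measure to serve every vertex
  \<open>x\<close>: \<open>J\<close> will be the other points when the weights are drawn, and the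
  pairs containing \<open>x\<close> when the edges are drawn.\<close>

lemma AE_PiM_not_summable_on:
  fixes f :: "'i \<Rightarrow> 'a \<Rightarrow> real"
  assumes M: "\<And>i. prob_space (M i)" and J: "J \<subseteq> I"
    and f[measurable]: "\<And>i. i \<in> J \<Longrightarrow> f i \<in> borel_measurable (M i)"
    and f01: "\<And>i x. i \<in> J \<Longrightarrow> 0 \<le> f i x" "\<And>i x. i \<in> J \<Longrightarrow> f i x \<le> 1"
    and div: "\<not> (\<lambda>i. \<integral>x. f i x \<partial>M i) summable_on J"
  shows "AE \<omega> in PiM I M. \<not> (\<lambda>i. f i (\<omega> i)) summable_on J"
proof -
  interpret prob_space "M i" for i
    by (rule M)
  interpret product_prob_space M I ..
  have "(\<integral>\<omega>. f i (\<omega> i) \<partial>PiM I M) = (\<integral>x. f i x \<partial>M i)" if "i \<in> J" for i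
  proof -
    have "(\<integral>x. f i x \<partial>M i) = (\<integral>x. f i x \<partial>distr (PiM I M) (M i) (\<lambda>\<omega>. \<omega> i))"
      using that J by (subst PiM_component) auto
    also have "\<dots> = (\<integral>\<omega>. f i (\<omega> i) \<partial>PiM I M)"
      using that J by (subst integral_distr) auto
    finally show ?thesis ..
  qed
  then have "\<not> (\<lambda>i. \<integral>\<omega>. f i (\<omega> i) \<partial>PiM I M) summable_on J"
    using div by (simp cong: summable_on_cong)
  then show ?thesis
    using f01 by (intro P.AE_indep_vars_not_summable_on
      P.indep_vars_compose2[OF P.indep_vars_subset[OF indep_vars_component J]]) auto
qed

section \<open>Poisson counts in dyadic shells\<close>

text \<open>Exponential tilting by the factor 2: for \<open>k \<le> t\<close> one has
  \<open>m ^ k = 2 ^ k * (m / 2) ^ k \<le> exp t * (m / 2) ^ k\<close>, and the remaining series is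
  bounded by \<open>exp (m / 2)\<close>.\<close>

lemma poisson_lower_tail_le:
  fixes m t :: real
  assumes m: "0 \<le> m" and K: "finite K" "\<And>k. k \<in> K \<Longrightarrow> real k \<le> t"
  shows "(\<Sum>k\<in>K. m ^ k / fact k * exp (- m)) \<le> exp (t - m / 2)"
proof -
  have exp2: "(2::real) ^ k \<le> exp t" if "real k \<le> t" for k
  proof -
    have "(2::real) ^ k \<le> exp 1 ^ k"
      using exp_ge_add_one_self[of 1] by (intro power_mono) auto
    also have "\<dots> = exp (real k)"
      by (simp add: exp_of_nat_mult[symmetric])
    finally show ?thesis
      using that by (meson exp_le_cancel_iff order_trans)
  qed
  have "(\<Sum>k\<in>K. m ^ k / fact k) \<le> (\<Sum>k\<in>K. exp t * ((m / 2) ^ k / fact k))"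
  proof (rule sum_mono)
    fix k assume "k \<in> K"
    then have "2 ^ k * ((m / 2) ^ k / fact k) \<le> exp t * ((m / 2) ^ k / fact k)"
      using m K(2) exp2 by (intro mult_right_mono) auto
    then show "m ^ k / fact k \<le> exp t * ((m / 2) ^ k / fact k)"
      by (simp add: power_divide)
  qed
  also have "\<dots> = exp t * (\<Sum>k\<in>K. (m / 2) ^ k /\<^sub>R fact k)"
    unfolding sum_distrib_left by (rule sum.cong[OF refl]) (simp only: real_scaleR_def divide_inverse_commute[of _ "fact _"])
  also have "\<dots> \<le> exp t * exp (m / 2)"
    unfolding exp_def[THEN fun_cong, of "m / 2"] using m K(1)
    by (intro mult_left_mono sum_le_suminf summable_exp_generic) auto
  finally have "(\<Sum>k\<in>K. m ^ k / fact k) * exp (- m) \<le> exp t * exp (m / 2) * exp (- m)"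
    by (intro mult_right_mono) auto
  then show ?thesis
    by (simp add: sum_distrib_right mult_exp_exp)
qed

lemma space_poisson_process:
  assumes "poisson_process_law \<nu> P"
  shows "space P = {\<eta>. locally_finite \<eta>}"
proof -
  have "space P = space configuration_space"
    using assms by (simp add: poisson_process_law_def)
  then show ?thesis
    by (simp add: configuration_space_def space_measure_of_conv)
qed

lemma poisson_process_lower_tail:
  fixes P :: "(real ^ 'n) set measure"
  assumes P: "poisson_process_law \<nu> P" and \<nu>: "\<nu> \<ge> 0"
    and A: "bounded A" "A \<in> sets borel" and t: "t \<le> \<nu> * measure lborel A / 4"
  shows "{\<eta> \<in> space P. real (card (\<eta> \<inter> A)) < t} \<in> sets P"
    and "measure P {\<eta> \<in> space P. real (card (\<eta> \<inter> A)) < t} \<le> exp (- t)"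
proof -
  interpret prob_space P
    using P by (simp add: poisson_process_law_def)
  define K where "K = {k::nat. real k < t}"
  have K: "finite K"
    by (rule finite_subset[of _ "{..nat \<lceil>t\<rceil>}"]) (auto simp: K_def le_nat_iff, linarith)
  have setsP: "{\<eta> \<in> space P. card (\<eta> \<inter> A) = k} \<in> sets P" for k
  proof -
    have "{\<eta>. locally_finite \<eta> \<and> card (\<eta> \<inter> A) = k} \<in> sets configuration_space"
      unfolding configuration_space_def using A by (subst sets_measure_of) auto
    moreover have "sets P = sets configuration_space"
      using P by (simp add: poisson_process_law_def)
    ultimately show ?thesis
      by (simp add: space_poisson_process[OF P])
  qed
  have eq: "{\<eta> \<in> space P. real (card (\<eta> \<inter> A)) < t} = (\<Union>k\<in>K. {\<eta> \<in> space P. card (\<eta> \<inter> A) = k})"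
    by (auto simp: K_def)
  show "{\<eta> \<in> space P. real (card (\<eta> \<inter> A)) < t} \<in> sets P"
    unfolding eq using K setsP by auto
  have "prob {\<eta> \<in> space P. real (card (\<eta> \<inter> A)) < t} \<le> (\<Sum>k\<in>K. prob {\<eta> \<in> space P. card (\<eta> \<inter> A) = k})"
    unfolding eq using K setsP by (intro finite_measure_subadditive_finite) auto
  also have "\<dots> = (\<Sum>k\<in>K. (\<nu> * measure lborel A) ^ k / fact k * exp (- (\<nu> * measure lborel A)))"
    using P A unfolding poisson_process_law_def by (intro sum.cong refl) blast
  also have "\<dots> \<le> exp (t - \<nu> * measure lborel A / 2)"
    using K \<nu> by (intro poisson_lower_tail_le) (auto simp: K_def)
  \<comment> \<open>With \<open>m\<close> the mean number of points, \<open>t \<le> m / 4\<close> is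
    equivalent to \<open>t - m / 2 \<le> - t\<close>.\<close>
  also have "\<dots> \<le> exp (- t)"
    using t by simp
  finally show "measure P {\<eta> \<in> space P. real (card (\<eta> \<inter> A)) < t} \<le> exp (- t)" .
qed

definition shell :: "nat \<Rightarrow> 'a::real_normed_vector set" where
  "shell k = ball 0 (2 ^ Suc k) - ball 0 (2 ^ k)"

lemma mem_shell: "y \<in> shell k \<longleftrightarrow> 2 ^ k \<le> norm y \<and> norm y < 2 ^ Suc k"
  by (auto simp: shell_def)

lemma bounded_shell: "bounded (shell k)"
  unfolding shell_def by (intro bounded_subset[OF bounded_ball]) auto

lemma borel_shell: "shell k \<in> sets borel"
  unfolding shell_def by simp

lemma disjoint_shells: "j \<noteq> k \<Longrightarrow> shell j \<inter> shell k = {}"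
proof (induction j k rule: linorder_less_wlog)
  case (less j k)
  then have "(2::real) ^ Suc j \<le> 2 ^ k"
    by (intro power_increasing) auto
  then show ?case
    by (force simp: mem_shell)
qed auto

text \<open>The exact volume is \<open>2 ^ d - 1\<close> times the left-hand side, and this factor
  is at least 1 because \<open>d \<ge> 1\<close>.\<close>

lemma measure_shell_ge:
  "unit_ball_vol (real DIM('a)) * 2 ^ (k * DIM('a)) \<le> measure lborel (shell k :: 'a::euclidean_space set)"
proof -
  let ?d = "DIM('a)"
  have "measure lborel (shell k :: 'a set) =
      measure lborel (ball 0 (2 ^ Suc k) :: 'a set) - measure lborel (ball 0 (2 ^ k) :: 'a set)"
    unfolding shell_def using emeasure_lborel_ball_finite[of "0 :: 'a"]
    by (intro measure_Diff subset_ball) (auto simp: less_top)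
  also have "\<dots> = unit_ball_vol (real ?d) * (2 ^ ?d * 2 ^ (k * ?d) - 2 ^ (k * ?d))"
    by (simp add: content_ball power_mult power_mult_distrib right_diff_distrib)
  also have "\<dots> \<ge> unit_ball_vol (real ?d) * 2 ^ (k * ?d)"
  proof (intro mult_left_mono)
    have "(2::real) ^ 1 \<le> 2 ^ ?d"
      by (intro power_increasing) (simp_all add: Suc_leI)
    then have "2 * 2 ^ (k * ?d) \<le> (2::real) ^ ?d * 2 ^ (k * ?d)"
      by (intro mult_right_mono) auto
    then show "(2::real) ^ (k * ?d) \<le> 2 ^ ?d * 2 ^ (k * ?d) - 2 ^ (k * ?d)"
      by simp
  qed simp
  finally show ?thesis .
qed

text \<open>First Borel-Cantelli lemma: too few points in shell \<open>k\<close> has probability at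
  most \<open>exp (- (c * 2 ^ (k * d)))\<close>, which is dominated by the geometric series of ratio
  \<open>exp (- c)\<close>.\<close>

lemma AE_poisson_process_shells:
  fixes P :: "(real ^ 'n) set measure"
  assumes P: "poisson_process_law \<nu> P" and \<nu>: "\<nu> > 0"
  obtains c :: real where "c > 0"
    "AE \<eta> in P. \<forall>\<^sub>F k in sequentially. c * 2 ^ (k * CARD('n)) \<le> real (card (\<eta> \<inter> shell k))"
proof -
  interpret prob_space P
    using P by (simp add: poisson_process_law_def)
  \<comment> \<open>A quarter of the lower bound for the mean count, as the hypothesis on
    \<open>t\<close> in \<open>poisson_process_lower_tail\<close> requires.\<close>
  define c where "c = \<nu> * unit_ball_vol (real CARD('n)) / 4"
  define B where "B k = {\<eta> \<in> space P. card (\<eta> \<inter> shell k) < c * 2 ^ (k * CARD('n))}" for k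
  have c: "c > 0"
    using \<nu> by (simp add: c_def)
  have t: "c * 2 ^ (k * CARD('n)) \<le> \<nu> * measure lborel (shell k :: (real ^ 'n) set) / 4" for k
    using measure_shell_ge[where 'a = "real ^ 'n", of k] \<nu> by (simp add: c_def)
  note tail = poisson_process_lower_tail[OF P less_imp_le[OF \<nu>] bounded_shell borel_shell t]
  have "summable (\<lambda>k. prob (B k))"
  proof (rule summable_comparison_test')
    show "summable (\<lambda>k. exp (- c) ^ k)"
      using c by (intro summable_geometric) simp
    show "norm (prob (B k)) \<le> exp (- c) ^ k" for k
    proof -
      have "real k \<le> 2 ^ k"
        by (metis less_exp less_imp_le of_nat_le_iff of_nat_numeral of_nat_power)
      also have "\<dots> \<le> (2::real) ^ (k * CARD('n))"
        by (intro power_increasing) (simp_all add: Suc_leI)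
      finally have "c * k \<le> c * 2 ^ (k * CARD('n))"
        using c by simp
      then have "exp (- (c * 2 ^ (k * CARD('n)))) \<le> exp (- (c * k))"
        by simp
      also have "\<dots> = exp (- c) ^ k"
        by (simp add: exp_of_nat_mult[symmetric] mult.commute)
      finally show ?thesis
        using tail(2)[of k] by (simp add: B_def)
    qed
  qed
  then have "AE \<eta> in P. \<forall>\<^sub>F k in sequentially. \<eta> \<in> space P - B k"
    using tail(1) by (intro borel_cantelli_AE1) (auto simp: B_def less_top[symmetric])
  then have "AE \<eta> in P. \<forall>\<^sub>F k in sequentially. c * 2 ^ (k * CARD('n)) \<le> real (card (\<eta> \<inter> shell k))"
    by eventually_elim (auto simp: B_def not_less elim!: eventually_mono)
  with c show thesis
    by (rule that)
qed

text \<open>For large \<open>k\<close> each point \<open>y\<close> of shell \<open>k\<close> is at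
  distance at most \<open>4 * 2 ^ k\<close> from \<open>x\<close>, so \<open>f y\<close> is at least
  \<open>c / (4 * 2 ^ k) ^ d\<close>. Multiplying by the number of points cancels
  \<open>2 ^ (k * d)\<close> and leaves the constant \<open>\<delta>\<close>. Finite unions of
  disjoint shells then have arbitrarily large sums.\<close>

lemma not_summable_on_shells:
  fixes f :: "'a::euclidean_space \<Rightarrow> real" and I :: "real \<Rightarrow> real" and b c :: real
  assumes \<eta>: "locally_finite \<eta>"
    and shells: "\<forall>\<^sub>F k in sequentially. b * 2 ^ (k * DIM('a)) \<le> real (card (\<eta> \<inter> shell k))" and b: "b > 0"
    and I: "\<forall>\<^sub>F r in at_top. c * r powr - real DIM('a) \<le> I r" and c: "c > 0"
    and f: "\<And>y. y \<in> \<eta> - {x} \<Longrightarrow> 0 \<le> f y" "\<And>y. y \<in> \<eta> - {x} \<Longrightarrow> I (norm (x - y)) \<le> f y"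
  shows "\<not> f summable_on (\<eta> - {x})"
proof -
  let ?d = "DIM('a)"
  define \<delta> where "\<delta> = b * c / 4 ^ ?d"
  have \<delta>: "\<delta> > 0"
    using b c by (simp add: \<delta>_def)
  obtain R where R: "\<And>r. r \<ge> R \<Longrightarrow> c * r powr - real ?d \<le> I r"
    using I by (auto simp: eventually_at_top_linorder)
  obtain K where K: "\<And>k. k \<ge> K \<Longrightarrow> b * 2 ^ (k * ?d) \<le> real (card (\<eta> \<inter> shell k))"
    using shells by (auto simp: eventually_sequentially)
  \<comment> \<open>Since \<open>norm y \<ge> 2 ^ k\<close>, this keeps the shells with
    \<open>k \<ge> K'\<close> at distance at least \<open>max R 1\<close> from \<open>x\<close>:
    beyond \<open>R\<close> the bound on \<open>I\<close> applies, and the 1 makes the distance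
    positive, so that \<open>y \<noteq> x\<close>.\<close>
  obtain K' where K': "norm x + max R 1 \<le> 2 ^ K'"
    by (metis less_imp_le one_less_numeral_iff real_arch_pow semiring_norm(76))
  define k0 where "k0 = max K K'"
  have fin: "finite (\<eta> \<inter> shell k)" for k
    using \<eta> bounded_shell by (auto simp: locally_finite_def)
  have far: "y \<noteq> x \<and> c / 4 ^ ?d / 2 ^ (k * ?d) \<le> I (norm (x - y))" if "k \<ge> k0" "y \<in> shell k" for k y
  proof -
    have "(2::real) ^ K' \<le> 2 ^ k"
      using that by (intro power_increasing) (auto simp: k0_def)
    with K' have k: "norm x + max R 1 \<le> 2 ^ k"
      by linarith
    have "norm y - norm x \<le> norm (x - y)" "norm (x - y) \<le> norm x + norm y"
      using norm_triangle_ineq2[of y x] norm_triangle_ineq4[of x y] by (simp_all add: norm_minus_commute)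
    with k that have r: "max R 1 \<le> norm (x - y)" "norm (x - y) \<le> 4 * 2 ^ k"
      by (auto simp: mem_shell)
    then have pos: "norm (x - y) > 0"
      by linarith
    have "c / 4 ^ ?d / 2 ^ (k * ?d) = c / (4 * 2 ^ k) ^ ?d"
      by (simp add: power_mult_distrib power_mult)
    also have "\<dots> \<le> c / norm (x - y) ^ ?d"
      using c r pos by (intro divide_left_mono power_mono) auto
    also have "\<dots> = c * norm (x - y) powr - real ?d"
      using pos by (simp add: powr_minus powr_realpow divide_inverse)
    also have "\<dots> \<le> I (norm (x - y))"
      using r by (intro R) auto
    finally show ?thesis
      using pos by auto
  qed
  have \<delta>_le: "\<delta> \<le> sum f (\<eta> \<inter> shell k)" if k: "k \<ge> k0" for k
  proof -
    have "\<delta> = b * 2 ^ (k * ?d) * (c / 4 ^ ?d / 2 ^ (k * ?d))"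
      by (simp add: \<delta>_def)
    also have "\<dots> \<le> card (\<eta> \<inter> shell k) * (c / 4 ^ ?d / 2 ^ (k * ?d))"
      using K[of k] k c by (intro mult_right_mono) (auto simp: k0_def)
    also have "\<dots> \<le> sum f (\<eta> \<inter> shell k)"
      using far[OF k] f(2) by (intro sum_bounded_below) (metis DiffI IntE order_trans singletonD)
    finally show ?thesis .
  qed
  have "\<exists>F. finite F \<and> F \<subseteq> \<eta> - {x} \<and> B < sum f F" for B
  proof -
    obtain n where n: "B < real n * \<delta>"
      using \<delta> reals_Archimedean3 by blast
    define F where "F = (\<Union>k\<in>{k0..<k0 + n}. \<eta> \<inter> shell k)"
    have "real n * \<delta> \<le> (\<Sum>k\<in>{k0..<k0 + n}. sum f (\<eta> \<inter> shell k))"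
      using sum_bounded_below[of "{k0..<k0 + n}" \<delta> "\<lambda>k. sum f (\<eta> \<inter> shell k)"] \<delta>_le by simp
    also have "\<dots> = sum f F"
      unfolding F_def using fin disjoint_shells
      by (intro sum.UNION_disjoint[symmetric]) auto
    finally show ?thesis
      using n
    proof (intro exI[of _ F] conjI)
      show "finite F"
        unfolding F_def using fin by blast
      show "F \<subseteq> \<eta> - {x}"
        using far by (fastforce simp: F_def)
    qed simp
  qed
  then show ?thesis
    by (subst not_summable_on_iff[OF f(1)]) auto
qed

section \<open>The edge probability averaged over one weight\<close>

text \<open>The integrand is nonnegative and increasing, so it is bounded below by its value at
  \<open>u\<close> on \<open>{u..}\<close> and by 0 elsewhere. Writing \<open>max 0 w\<close> keeps
  it in \<open>[0, 1]\<close> at every real \<open>w\<close>, as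
  \<open>AE_PiM_not_summable_on\<close> demands, and changes nothing for positive weights.\<close>

lemma (in real_distribution) integral_exp_ge:
  assumes "\<beta> > 0" "u \<ge> 0"
  shows "(1 - exp (- (\<beta> * u))) * prob {u..} \<le> expectation (\<lambda>w. 1 - exp (- (\<beta> * max 0 w)))"
proof -
  have "(1 - exp (- (\<beta> * u))) * prob {u..} = expectation (\<lambda>w. (1 - exp (- (\<beta> * u))) * indicator {u..} w)"
    by simp
  also have "\<dots> \<le> expectation (\<lambda>w. 1 - exp (- (\<beta> * max 0 w)))"
  proof (rule integral_mono)
    show "integrable M (\<lambda>w. (1 - exp (- (\<beta> * u))) * indicator {u..} w)"
      using assms by (intro integrable_const_bound[where B = 1]) (auto simp: indicator_def)
    show "integrable M (\<lambda>w. 1 - exp (- (\<beta> * max 0 w)))"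
      using assms by (intro integrable_const_bound[where B = 1]) auto
  qed (use assms in \<open>auto simp: indicator_def\<close>)
  finally show ?thesis .
qed

text \<open>Both cases apply \<open>integral_exp_ge\<close>: with a fixed threshold
  \<open>\<epsilon>\<close> of positive mass if \<open>\<alpha> \<le> d\<close>, and otherwise with
  the growing threshold \<open>r powr \<alpha>\<close>, at which the exponent equals
  \<open>a\<close> and only the tail of the weight depends on \<open>r\<close>. The number
  \<open>a\<close> stands for a lower bound on the weight at the other end of the edge.\<close>

lemma (in real_distribution) edge_probability_decay:
  assumes pos: "AE w in M. w > 0" and \<alpha>: "\<alpha> > 0" and a: "a > 0"
    and cond: "\<alpha> \<le> d \<or>
      (\<exists>c>0. \<exists>\<tau>>1. eventually (\<lambda>w. 1 - cdf M w \<ge> c * w powr (- (\<tau> - 1))) at_top \<and>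
         \<alpha> * (\<tau> - 1) / d \<le> 1)" and d: "d > 0"
  obtains c where "c > 0"
    "\<forall>\<^sub>F r in at_top. c * r powr - d \<le> expectation (\<lambda>w. 1 - exp (- (a / r powr \<alpha> * max 0 w)))"
proof (cases "\<alpha> \<le> d")
  case True
  \<comment> \<open>If no threshold \<open>1 / (n + 1)\<close> had positive mass, the weight would
    almost surely lie below all of them, against positivity.\<close>
  have "\<exists>n. prob {1 / real (Suc n)..} \<noteq> 0"
  proof (rule ccontr)
    assume "\<nexists>n. prob {1 / real (Suc n)..} \<noteq> 0"
    then have "AE w in M. w < 1 / real (Suc n)" for n
      by (intro AE_I[where N = "{1 / real (Suc n)..}"]) (auto simp: emeasure_eq_measure)
    then have "AE w in M. \<forall>n. w < 1 / real (Suc n)"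
      by (simp add: AE_all_countable)
    with pos have "AE w in M. False"
    proof eventually_elim
      case (elim w)
      then show ?case
        using reals_Archimedean[of w] by (auto simp: inverse_eq_divide dest: less_asym)
    qed
    then show False
      by (simp add: AE_False)
  qed
  then obtain \<epsilon> :: real where \<epsilon>: "\<epsilon> > 0" "prob {\<epsilon>..} > 0"
    by (metis divide_pos_pos measure_nonneg of_nat_0_less_iff order_le_less zero_less_Suc zero_less_one)
  \<comment> \<open>From \<open>t * exp (- t) \<le> 1 - exp (- t)\<close> with
    \<open>t = a * \<epsilon> / r powr \<alpha>\<close>, where \<open>t \<le> a * \<epsilon>\<close>
    once \<open>r \<ge> 1\<close>.\<close>
  let ?c = "a * \<epsilon> * exp (- (a * \<epsilon>)) * prob {\<epsilon>..}"
  show thesis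
  proof (rule that[of ?c])
    show "?c > 0"
      using a \<epsilon> by simp
    show "\<forall>\<^sub>F r in at_top. ?c * r powr - d \<le> expectation (\<lambda>w. 1 - exp (- (a / r powr \<alpha> * max 0 w)))"
      using eventually_ge_at_top[of 1]
    proof eventually_elim
      case (elim r)
      define t where "t = a / r powr \<alpha> * \<epsilon>"
      have "r powr \<alpha> \<ge> 1"
        using elim \<alpha> by (intro ge_one_powr_ge_zero) auto
      then have "a / r powr \<alpha> \<le> a / 1" "a / r powr \<alpha> > 0"
        using a elim by (intro divide_left_mono divide_pos_pos; simp)+
      then have t: "t \<le> a * \<epsilon>" "t > 0"
        unfolding t_def using \<epsilon> by (intro mult_right_mono mult_pos_pos; simp)+
      have "?c * r powr - d \<le> ?c * r powr - \<alpha>"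
        using a \<epsilon> True elim by (intro mult_left_mono powr_mono) auto
      also have "\<dots> = t * exp (- (a * \<epsilon>)) * prob {\<epsilon>..}"
        by (simp add: t_def powr_minus divide_inverse)
      also have "\<dots> \<le> t * exp (- t) * prob {\<epsilon>..}"
        using t by (intro mult_right_mono mult_left_mono) auto
      also have "t * exp (- t) \<le> 1 - exp (- t)"
        using exp_ge_add_one_self[of t] by (simp add: exp_minus field_simps)
      then have "t * exp (- t) * prob {\<epsilon>..} \<le> (1 - exp (- t)) * prob {\<epsilon>..}"
        by (intro mult_right_mono) auto
      also have "\<dots> \<le> expectation (\<lambda>w. 1 - exp (- (a / r powr \<alpha> * max 0 w)))"
        unfolding t_def using elim a \<epsilon> by (intro integral_exp_ge) auto
      finally show ?case .
    qed
  qed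
next
  case False
  with cond obtain c \<tau> where c: "c > 0" and \<tau>: "\<tau> > 1" "\<alpha> * (\<tau> - 1) / d \<le> 1"
    and tail: "\<forall>\<^sub>F w in at_top. 1 - cdf M w \<ge> c * w powr (- (\<tau> - 1))"
    by auto
  let ?c = "(1 - exp (- a)) * c"
  show thesis
  proof (rule that[of ?c])
    show "?c > 0"
      using a c by simp
    have "filterlim (\<lambda>r::real. r powr \<alpha>) at_top at_top"
      using \<alpha> by real_asymp
    from eventually_compose_filterlim[OF tail this] eventually_ge_at_top[of 1]
    show "\<forall>\<^sub>F r in at_top. ?c * r powr - d \<le> expectation (\<lambda>w. 1 - exp (- (a / r powr \<alpha> * max 0 w)))"
    proof eventually_elim
      case (elim r)
      \<comment> \<open>The condition \<open>\<alpha> * (\<tau> - 1) / d \<le> 1\<close> compares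
        the exponents, and \<open>r \<ge> 1\<close> makes the comparison go in the right
        direction.\<close>
      have "r powr - d \<le> (r powr \<alpha>) powr (- (\<tau> - 1))"
        unfolding powr_powr using \<tau> d elim by (intro powr_mono) (auto simp: field_simps)
      then have "c * r powr - d \<le> 1 - cdf M (r powr \<alpha>)"
        using elim c by (meson less_imp_le mult_left_mono order_trans)
      also have "\<dots> = prob {r powr \<alpha><..}"
        using prob_compl[of "{..r powr \<alpha>}"] by (simp add: cdf_def Compl_eq_Diff_UNIV[symmetric])
      also have "\<dots> \<le> prob {r powr \<alpha>..}"
        by (intro finite_measure_mono) auto
      finally have "?c * r powr - d \<le> (1 - exp (- (a / r powr \<alpha> * r powr \<alpha>))) * prob {r powr \<alpha>..}"
        using a elim by (simp add: mult.assoc)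
      also have "\<dots> \<le> expectation (\<lambda>w. 1 - exp (- (a / r powr \<alpha> * max 0 w)))"
        using elim a by (intro integral_exp_ge) auto
      finally show ?case .
    qed
  qed
qed

section \<open>Measurability of the degree event\<close>

lemma countable_locally_finite:
  fixes \<eta> :: "'a::real_normed_vector set"
  assumes "locally_finite \<eta>"
  shows "countable \<eta>"
proof -
  have "\<eta> = (\<Union>n::nat. \<eta> \<inter> ball 0 (real n))"
    using reals_Archimedean2 by auto
  moreover have "countable (\<eta> \<inter> ball 0 (real n))" for n
    using assms by (auto simp: locally_finite_def intro: countable_finite)
  ultimately show ?thesis
    by (metis countable_UN countableI_type)
qed

lemma vertex_degree_eq_infinity_iff:
  "vertex_degree \<eta> G x = \<infinity> \<longleftrightarrow> infinite {y \<in> \<eta>. y \<noteq> x \<and> snd G {x, y}}"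
  by (simp add: vertex_degree_def Let_def)

lemma pred_Bex_countable:
  assumes "countable X" "\<And>i. i \<in> X \<Longrightarrow> Measurable.pred M (\<lambda>x. P x i)"
  shows "Measurable.pred M (\<lambda>x. \<exists>i\<in>X. P x i)"
proof -
  have "{x \<in> space M. \<exists>i\<in>X. P x i} = (\<Union>i\<in>X. {x \<in> space M. P x i})"
    by auto
  then show ?thesis
    using assms sets.countable_UN''[of X "\<lambda>i. {x \<in> space M. P x i}" M] by (simp add: pred_def)
qed

lemma pred_Ball_countable:
  assumes "countable X" "\<And>i. i \<in> X \<Longrightarrow> Measurable.pred M (\<lambda>x. P x i)"
  shows "Measurable.pred M (\<lambda>x. \<forall>i\<in>X. P x i)"
proof -
  have "Measurable.pred M (\<lambda>x. \<not> (\<exists>i\<in>X. \<not> P x i))"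
    using assms by (intro pred_intros_logic pred_Bex_countable) auto
  then show ?thesis
    by simp
qed

text \<open>Measurability lets the almost sure statement pass through \<open>distr\<close> and
  \<open>bind\<close>. Infinite degree means that no finite \<open>F\<close> contains all
  neighbours, and a countable \<open>\<eta>\<close> has only countably many finite subsets.\<close>

lemma pred_vertex_degree_infinite:
  fixes \<eta> :: "'a set"
  assumes \<eta>: "countable \<eta>"
  shows "Measurable.pred (graph_space \<eta>) (\<lambda>G. \<forall>x\<in>\<eta>. vertex_degree \<eta> G x = \<infinity>)"
proof -
  have edge: "Measurable.pred (graph_space \<eta>) (\<lambda>G. snd G {x, y})"
    if "x \<in> \<eta>" "y \<in> \<eta>" "x \<noteq> y" for x y
  proof -
    have "{x, y} \<in> vertex_pairs \<eta>"
      using that by (auto simp: vertex_pairs_def)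
    then show ?thesis
      unfolding graph_space_def by measurable
  qed
  have deg: "vertex_degree \<eta> G x = \<infinity> \<longleftrightarrow>
      (\<forall>F\<in>{F. finite F \<and> F \<subseteq> \<eta>}. \<exists>y\<in>\<eta> - F - {x}. snd G {x, y})" for G x
  proof -
    let ?N = "{y \<in> \<eta>. y \<noteq> x \<and> snd G {x, y}}"
    have "infinite ?N \<longleftrightarrow> (\<forall>F. finite F \<and> F \<subseteq> \<eta> \<longrightarrow> \<not> ?N \<subseteq> F)"
      by (metis (mono_tags, lifting) finite_subset mem_Collect_eq order_refl subsetI)
    then show ?thesis
      unfolding vertex_degree_eq_infinity_iff by blast
  qed
  show ?thesis
    unfolding deg using \<eta>
    by (intro pred_Ball_countable pred_Bex_countable countable_Collect_finite_subset edge) auto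
qed

section \<open>Drawing the weights, then the edges\<close>

text \<open>The random factor \<open>w x\<close> is common to all edges at \<open>x\<close>, so
  their probabilities are not independent. Replacing it by the constants \<open>1 / (n + 1)\<close>
  leaves independent terms. Divergence holds almost surely for all \<open>n\<close> at once, and
  some such constant lies below the positive number \<open>w x\<close>.\<close>

lemma AE_weights_not_summable_on:
  fixes \<eta> :: "'a::euclidean_space set"
  assumes D: "real_distribution D" "AE w in D. w > 0"
    and \<eta>: "countable \<eta>" "x \<in> \<eta>"
    and div: "\<And>a. a > 0 \<Longrightarrow>
      \<not> (\<lambda>y. \<integral>w. 1 - exp (- (a / norm (x - y) powr \<alpha> * max 0 w)) \<partial>D) summable_on (\<eta> - {x})"
  shows "AE w in PiM \<eta> (\<lambda>_. D). (\<forall>y\<in>\<eta>. w y > 0) \<and>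
    \<not> (\<lambda>y. edge_prob \<alpha> w {x, y}) summable_on (\<eta> - {x})"
proof -
  interpret D: real_distribution D by fact
  have "AE w in PiM \<eta> (\<lambda>_. D). \<forall>y\<in>\<eta>. w y > 0"
    using D(2) \<eta>(1)
    by (intro AE_ball_countable' AE_PiM_component[where P = "\<lambda>w. w > 0"] D.prob_space_axioms) auto
  moreover have "AE w in PiM \<eta> (\<lambda>_. D). \<forall>n.
    \<not> (\<lambda>y. 1 - exp (- (1 / real (Suc n) / norm (x - y) powr \<alpha> * max 0 (w y)))) summable_on (\<eta> - {x})"
    unfolding AE_all_countable
    by (intro allI AE_PiM_not_summable_on
        [where f = "\<lambda>y w. 1 - exp (- (1 / real (Suc n) / norm (x - y) powr \<alpha> * max 0 w))" for n]
        D.prob_space_axioms div) auto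
  ultimately show ?thesis
  proof eventually_elim
    case (elim w)
    obtain n where n: "1 / real (Suc n) \<le> w x"
      using elim \<eta>(2) by (metis less_imp_le nat_approx_posE)
    have "1 - exp (- (1 / real (Suc n) / norm (x - y) powr \<alpha> * max 0 (w y))) \<le> edge_prob \<alpha> w {x, y}"
      if "y \<in> \<eta> - {x}" for y
    proof -
      have "w y > 0" "x \<noteq> y"
        using elim that by auto
      then have "1 / real (Suc n) * (w y / norm (x - y) powr \<alpha>) \<le> w x * (w y / norm (x - y) powr \<alpha>)"
        using n by (intro mult_right_mono) auto
      then show ?thesis
        using \<open>w y > 0\<close> \<open>x \<noteq> y\<close> by (simp add: edge_prob_pair)
    qed
    then have "(\<lambda>y. 1 - exp (- (1 / real (Suc n) / norm (x - y) powr \<alpha> * max 0 (w y)))) summable_on (\<eta> - {x})"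
      if "(\<lambda>y. edge_prob \<alpha> w {x, y}) summable_on (\<eta> - {x})"
      by (rule summable_on_comparison_test[OF that]) auto
    with elim show ?case
      by blast
  qed
qed

text \<open>Given the weights, the edge indicators at \<open>x\<close> are independent with
  divergent sum of expectations, so the sum of the indicators diverges too. It could not if only
  finitely many were nonzero.\<close>

lemma AE_edge_law_infinite:
  fixes \<eta> :: "'a::real_normed_vector set"
  assumes w: "\<And>y. y \<in> \<eta> \<Longrightarrow> w y > 0" and x: "x \<in> \<eta>"
    and div: "\<not> (\<lambda>y. edge_prob \<alpha> w {x, y}) summable_on (\<eta> - {x})"
  shows "AE E in edge_law \<alpha> \<eta> w. infinite {y \<in> \<eta>. y \<noteq> x \<and> E {x, y}}"
proof -
  let ?J = "(\<lambda>y. {x, y}) ` (\<eta> - {x})"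
  have inj: "inj_on (\<lambda>y. {x, y}) (\<eta> - {x})"
    by (auto simp: inj_on_def doubleton_eq_iff)
  \<comment> \<open>Within \<open>[0, 1]\<close> the Bernoulli parameter is not clipped, so the
    expectation of an indicator is \<open>edge_prob\<close> itself.\<close>
  have "0 \<le> edge_prob \<alpha> w e" "edge_prob \<alpha> w e \<le> 1" if e: "e \<in> ?J" for e
  proof -
    obtain y where y: "e = {x, y}" "y \<in> \<eta> - {x}"
      using e by blast
    then have "x \<noteq> y"
      by blast
    with y show "0 \<le> edge_prob \<alpha> w e" "edge_prob \<alpha> w e \<le> 1"
      using w x by (auto simp: edge_prob_pair less_imp_le)
  qed
  then have "(\<lambda>e. \<integral>b. (of_bool b :: real) \<partial>measure_pmf (bernoulli_pmf (edge_prob \<alpha> w e))) summable_on ?J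
      \<longleftrightarrow> edge_prob \<alpha> w summable_on ?J"
    by (intro summable_on_cong) (simp add: integral_bernoulli_pmf)
  also have "\<dots> \<longleftrightarrow> (\<lambda>y. edge_prob \<alpha> w {x, y}) summable_on (\<eta> - {x})"
    by (simp add: summable_on_reindex[OF inj] comp_def)
  finally have "AE E in edge_law \<alpha> \<eta> w. \<not> (\<lambda>e. of_bool (E e) :: real) summable_on ?J"
    unfolding edge_law_def using div x
    by (intro AE_PiM_not_summable_on prob_space_measure_pmf) (auto simp: vertex_pairs_def)
  then show ?thesis
  proof eventually_elim
    case (elim E)
    show ?case
    proof
      let ?N = "{y \<in> \<eta>. y \<noteq> x \<and> E {x, y}}"
      assume "finite ?N"
      then have "(\<lambda>y. of_bool (E {x, y}) :: real) summable_on ?N"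
        by simp
      then have "(\<lambda>y. of_bool (E {x, y}) :: real) summable_on (\<eta> - {x})"
        by (rule summable_on_cong_neutral[THEN iffD1, rotated -1]) auto
      then show False
        using elim by (simp add: summable_on_reindex[OF inj] comp_def)
    qed
  qed
qed

lemma AE_quenched_law_infinite_degree:
  fixes \<eta> :: "'a::euclidean_space set"
  assumes D: "real_distribution D" "AE w in D. w > 0" and \<eta>: "countable \<eta>"
    and div: "\<And>a x. a > 0 \<Longrightarrow> x \<in> \<eta> \<Longrightarrow>
      \<not> (\<lambda>y. \<integral>w. 1 - exp (- (a / norm (x - y) powr \<alpha> * max 0 w)) \<partial>D) summable_on (\<eta> - {x})"
  shows "AE G in quenched_law D \<alpha> \<eta>. \<forall>x\<in>\<eta>. vertex_degree \<eta> G x = \<infinity>"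
proof -
  interpret D: real_distribution D by fact
  note pred = pred_vertex_degree_infinite[OF \<eta>]
  note kernel = measurable_quenched_kernel[OF D.events_eq_borel, of \<alpha> \<eta>]
  \<comment> \<open>Countability of \<open>\<eta>\<close> allows one null set of weights to serve
    all vertices \<open>x\<close>.\<close>
  have "AE w in PiM \<eta> (\<lambda>_. D). \<forall>x\<in>\<eta>. (\<forall>y\<in>\<eta>. w y > 0) \<and>
      \<not> (\<lambda>y. edge_prob \<alpha> w {x, y}) summable_on (\<eta> - {x})"
    using D \<eta> div by (intro AE_ball_countable' AE_weights_not_summable_on) auto
  then have "AE w in PiM \<eta> (\<lambda>_. D). AE G in distr (edge_law \<alpha> \<eta> w) (graph_space \<eta>) (Pair w).
      \<forall>x\<in>\<eta>. vertex_degree \<eta> G x = \<infinity>"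
    using AE_space
  proof eventually_elim
    case (elim w)
    \<comment> \<open>Measurability of \<open>Pair w\<close> into the product space rests on
      \<open>w\<close> being a point of the first factor.\<close>
    have "w \<in> space (PiM \<eta> (\<lambda>_. borel))"
      using elim by (simp add: space_PiM)
    then have [measurable]: "Pair w \<in> edge_law \<alpha> \<eta> w \<rightarrow>\<^sub>M graph_space \<eta>"
      using measurable_Pair1'[of w "PiM \<eta> (\<lambda>_. borel)" "PiM (vertex_pairs \<eta>) (\<lambda>_. count_space UNIV)"]
      by (simp add: graph_space_def edge_law_def cong: measurable_cong_sets sets_PiM_cong)
    have "AE E in edge_law \<alpha> \<eta> w. \<forall>x\<in>\<eta>. infinite {y \<in> \<eta>. y \<noteq> x \<and> E {x, y}}"
      using elim by (intro AE_ball_countable'[OF _ \<eta>] AE_edge_law_infinite) auto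
    then show ?case
      using pred by (subst AE_distr_iff) (auto simp: vertex_degree_eq_infinity_iff pred_def)
  qed
  then show ?thesis
    unfolding quenched_law_def
    by (subst AE_bind[OF measurable_prob_algebraD[OF kernel] pred])
qed

theorem theorem2p2:
  fixes \<nu> \<alpha> \<tau>\<^sub>0 :: real and P :: "(real ^ 'n) set measure"
    and D :: "real measure" and L :: "real \<Rightarrow> real"
  assumes "\<nu> > 0" and "\<alpha> > 0"
    and "poisson_process_law \<nu> P"
    and "real_distribution D" and "AE w in D. w > 0"
    and "\<tau>\<^sub>0 > 1" and "slowly_varying L"
    and "\<And>w. w > 0 \<Longrightarrow> 1 - cdf D w = w powr (- (\<tau>\<^sub>0 - 1)) * L w"
    and "\<alpha> \<le> real CARD('n) \<or>
      (\<exists>c>0. \<exists>\<tau>>1. eventually (\<lambda>w. 1 - cdf D w \<ge> c * w powr (- (\<tau> - 1))) at_top \<and>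
         \<alpha> * (\<tau> - 1) / real CARD('n) \<le> 1)"
  shows "AE \<eta> in P. AE G in quenched_law D \<alpha> \<eta>. \<forall>x\<in>\<eta>. vertex_degree \<eta> G x = \<infinity>"
proof -
  interpret D: real_distribution D by fact
  obtain b :: real where b: "b > 0"
    "AE \<eta> in P. \<forall>\<^sub>F k in sequentially. b * 2 ^ (k * CARD('n)) \<le> real (card (\<eta> \<inter> shell k))"
    using AE_poisson_process_shells[OF assms(3,1)] .
  from b(2) AE_space[of P] show ?thesis
  proof eventually_elim
    case (elim \<eta>)
    then have \<eta>: "locally_finite \<eta>"
      using space_poisson_process[OF assms(3)] by simp
    show ?case
    proof (rule AE_quenched_law_infinite_degree[OF assms(4,5) countable_locally_finite[OF \<eta>]])
      \<comment> \<open>The null set of configurations was fixed by the shell counts alone. Hence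
        \<open>a\<close> and \<open>x\<close> may be arbitrary here, and \<open>c\<close> may depend
        on \<open>a\<close>.\<close>
      fix a :: real and x assume "a > 0" "x \<in> \<eta>"
      let ?p = "\<lambda>r. \<integral>w. 1 - exp (- (a / r powr \<alpha> * max 0 w)) \<partial>D"
      obtain c where c: "c > 0" "\<forall>\<^sub>F r in at_top. c * r powr - real CARD('n) \<le> ?p r"
        using D.edge_probability_decay[OF assms(5,2) \<open>a > 0\<close> assms(9)] by auto
      show "\<not> (\<lambda>y. ?p (norm (x - y))) summable_on (\<eta> - {x})"
        using \<open>a > 0\<close> elim b c \<eta>
        by (intro not_summable_on_shells[where I = ?p and b = b and c = c])
          (auto intro!: integral_nonneg_AE)
    qed
  qed
qed

end
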